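(* Let $N\ge 1$ and $\alpha\in(0,1)$. For $i=1,\ldots,N$ let $\mathbb P_i$ be the posterior predictive distribution of the outcome $y_i\ge 0$ of unit $i$, with an atom at zero and a continuous part with continuous density $p_{c,i}(y)$, $y\ge 0$ (so $\mathbb P_i\{y_i=0\}+\int_0^\infty p_{c,i}(y)\,dy=1$). For thresholds $\kappa_1,\ldots,\kappa_N$ consider the highest posterior density (HPD) set forecasts $$C_i(\kappa_i)=\{0\}\cup\{y\ge 0:\ p_{c,i}(y)\ge\kappa_i\},\qquad i=1,\ldots,N.$$ If the objective is to minimize the average length of the set forecasts across $i$ subject to the coverage constraint holding only on average, $\frac1N\sum_{i=1}^N\mathbb P_i\{y_i\in C_i\}\ge 1-\alpha$, then the unit-specific thresholds $\kappa_i$ are to be replaced by a common threshold $\kappa$ that applies to all units $i$, i.e. $C_i=C_i(\kappa)$ for all $i$. The common threshold is optimal in the following sense. Starting from the common threshold $\kappa$, lower the threshold for a unit $i$ to $\kappa_i<\kappa$ and raise it for a unit $j$ to $\kappa_j>\kappa$, so that the set of unit $i$ is lengthened by $\delta_i>0$ and the length of the set of unit $j$ changes by $\delta_j<0$, while the overall (average) coverage probability is held constant. Then $\delta_i>-\delta_j$, so the overall average length increases and the uniform threshold $\kappa$ dominates.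
   Context: In the application, $\mathbb P_i$ is the posterior predictive distribution of a censored outcome of unit $i$ in a panel Tobit model, given the observed panel data. The predictive distribution of the latent uncensored variable has support that includes negative values, so the probability of the atom at zero (censoring) is strictly positive. Set forecasts have the form $\{0\}\cup\bigcup_{k=1}^{K_i}[a_{ik},b_{ik}]$ with $a_{i1}<b_{i1}<a_{i2}<\cdots<b_{iK_i}$ (equal to $\{0\}$ if $K_i=0$, and possibly empty for some units when average coverage is targeted). The length of such a set is $\sum_{k=1}^{K_i}(b_{ik}-a_{ik})$, so the point $0$ contributes no length. By contrast, when coverage of at least $1-\alpha$ is required for each unit separately, the shortest set for unit $i$ is $\{0\}$ if $\mathbb P_i\{y_i=0\}\ge 1-\alpha$. Otherwise it is $C_i(\kappa_i)$ with a unit-specific $\kappa_i$ chosen so that $\mathbb P_i\{y_i\in C_i(\kappa_i)\}=1-\alpha$.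
   Formalization: Optimality is stated for a common threshold with average coverage exactly 1−α; its existence is claimed if the average atom is below 1−α and densities have no plateaus of positive length. With plateaus no common threshold need be optimal; if atoms alone reach 1−α, {0} trivially is. *)

theory Defs
  imports "HOL-Probability.Probability"
begin

(* M is a law on the half line [0, \<infinity>) that consists of an atom at zero, of strictly
   positive mass, and of a part with continuous density p.  The values of p on the
   negative half line are irrelevant. *)
definition censored_predictive :: "real measure \<Rightarrow> (real \<Rightarrow> real) \<Rightarrow> bool" where
  "censored_predictive M p \<longleftrightarrow>
     prob_space M \<and> sets M = sets borel \<and>
     continuous_on {0..} p \<and> (\<forall>y\<ge>0. 0 \<le> p y) \<and>
     0 < measure M {0} \<and>
     (\<forall>A\<in>sets borel. emeasure M A =
        emeasure M {0} * indicator A 0 + (\<integral>\<^sup>+ y\<in>A \<inter> {0..}. ennreal (p y) \<partial>lborel))"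

definition hpd_set :: "(real \<Rightarrow> real) \<Rightarrow> real \<Rightarrow> real set" where
  "hpd_set p \<kappa> = {0} \<union> {y. 0 \<le> y \<and> \<kappa> \<le> p y}"

(* Lebesgue measure rather than a sum of interval lengths, because a superlevel set of an
   arbitrary continuous density need not be a finite union of intervals.  On such unions
   the two agree: see forecast_length_intervals.  Values are extended reals since
   hpd_set p \<kappa> is the whole half line for \<kappa> \<le> 0. *)
definition forecast_length :: "real set \<Rightarrow> ereal" where
  "forecast_length A = enn2ereal (emeasure lborel A)"

lemma forecast_length_intervals:
  fixes a b :: "nat \<Rightarrow> real"
  assumes "\<And>k. k \<in> {1..K} \<Longrightarrow> a k < b k"
    and "\<And>k. 1 \<le> k \<Longrightarrow> k < K \<Longrightarrow> b k < a (Suc k)"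
  shows "forecast_length ({0} \<union> (\<Union>k\<in>{1..K}. {a k..b k})) = ereal (\<Sum>k=1..K. b k - a k)"
proof -
  have gap: "b k < a l" if "1 \<le> k" "k < l" "l \<le> K" for k l
    using \<open>k < l\<close> \<open>l \<le> K\<close>
  proof (induction l)
    case 0
    then show ?case by simp
  next
    case (Suc l)
    show ?case
    proof (cases "k = l")
      case True
      then show ?thesis using assms(2)[of k] Suc that(1) by simp
    next
      case False
      with Suc have "b k < a l" by simp
      also have "a l < b l" using assms(1)[of l] Suc that(1) by simp
      also have "b l < a (Suc l)" using assms(2)[of l] Suc that(1) by simp
      finally show ?thesis .
    qed
  qed
  have disj: "disjoint_family_on (\<lambda>k. {a k..b k}) {1..K}"
    unfolding disjoint_family_on_def
  proof (intro ballI impI)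
    fix k l assume kl: "k \<in> {1..K}" "l \<in> {1..K}" "k \<noteq> l"
    then consider "k < l" | "l < k" by linarith
    then show "{a k..b k} \<inter> {a l..b l} = {}"
      using gap[of k l] gap[of l k] kl by cases auto
  qed
  have "emeasure lborel ({0} \<union> (\<Union>k\<in>{1..K}. {a k..b k})) = emeasure lborel (\<Union>k\<in>{1..K}. {a k..b k})"
    using emeasure_Un_null_set[of "\<Union>k\<in>{1..K}. {a k..b k}" lborel "{0}"]
    by (simp add: Un_commute null_setsI)
  also have "\<dots> = (\<Sum>k=1..K. emeasure lborel {a k..b k})"
    by (rule sum_emeasure[symmetric]) (use disj in auto)
  also have "\<dots> = (\<Sum>k=1..K. ennreal (b k - a k))"
    using assms(1) by (intro sum.cong refl) (auto simp: less_imp_le)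
  also have "\<dots> = ennreal (\<Sum>k=1..K. b k - a k)"
    using assms(1) by (intro sum_ennreal) (auto simp: less_imp_le)
  finally have len: "emeasure lborel ({0} \<union> (\<Union>k\<in>{1..K}. {a k..b k})) = ennreal (\<Sum>k=1..K. b k - a k)" .
  have "0 \<le> (\<Sum>k=1..K. b k - a k)"
    using assms(1) by (intro sum_nonneg) (auto simp: less_imp_le)
  then show ?thesis
    unfolding forecast_length_def len by (rule enn2ereal_ennreal)
qed

definition avg_length :: "nat \<Rightarrow> (nat \<Rightarrow> real set) \<Rightarrow> ereal" where
  "avg_length N C = (\<Sum>i=1..N. forecast_length (C i)) / ereal (real N)"

definition avg_coverage :: "nat \<Rightarrow> (nat \<Rightarrow> real measure) \<Rightarrow> (nat \<Rightarrow> real set) \<Rightarrow> real" where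
  "avg_coverage N P C = (\<Sum>i=1..N. measure (P i) (C i)) / real N"

(* Individual sets may be empty: only average coverage is required. *)
definition feasible_forecast ::
    "nat \<Rightarrow> (nat \<Rightarrow> real measure) \<Rightarrow> real \<Rightarrow> (nat \<Rightarrow> real set) \<Rightarrow> bool" where
  "feasible_forecast N P \<alpha> C \<longleftrightarrow>
     (\<forall>i\<in>{1..N}. C i \<in> sets borel \<and> C i \<subseteq> {0..}) \<and> 1 - \<alpha> \<le> avg_coverage N P C"

definition shortest_forecast ::
    "nat \<Rightarrow> (nat \<Rightarrow> real measure) \<Rightarrow> real \<Rightarrow> (nat \<Rightarrow> real set) \<Rightarrow> bool" where
  "shortest_forecast N P \<alpha> C \<longleftrightarrow>
     feasible_forecast N P \<alpha> C \<and>
     (\<forall>D. feasible_forecast N P \<alpha> D \<longrightarrow> avg_length N C \<le> avg_length N D)"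

end

(* Pointwise, on the half line and away from 0, kappa 1_C + p 1_D <= kappa 1_D + p 1_C for
   C = hpd_set p kappa and an arbitrary D.  Integrating gives
   kappa |C| + P(D) <= kappa |D| + P(C) (Neyman-Pearson), and summing over the units yields
   optimality of a common threshold; the inequality is strict when D is a longer superlevel set,
   which gives the comparison of perturbed thresholds.  The threshold exists by the
   intermediate value theorem, since coverage is continuous when level sets are null. *)
theory Submission
  imports Defs
begin

section \<open>HPD sets and a single censored predictive law\<close>

lemma hpd_set_subset: "hpd_set p \<kappa> \<subseteq> {0..}"
  by (auto simp: hpd_set_def)

lemma zero_in_hpd_set: "0 \<in> hpd_set p \<kappa>"
  by (simp add: hpd_set_def)

context
  fixes M :: "real measure" and p :: "real \<Rightarrow> real"
  assumes cp: "censored_predictive M p"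
begin

lemma prob_space_cp: "prob_space M"
  and sets_cp: "sets M = sets borel"
  and density_nonneg_cp: "0 \<le> y \<Longrightarrow> 0 \<le> p y"
  using cp by (auto simp: censored_predictive_def)

lemma space_cp: "space M = UNIV"
  using sets_eq_imp_space_eq[OF sets_cp] by simp

interpretation prob_space M
  by (rule prob_space_cp)

text \<open>Nothing is known about \<open>p\<close> at negative points, so \<open>p\<close> itself
  may fail to be measurable; its truncation to the half line stands in for it in the integrals
  below.\<close>

lemma measurable_density_cp: "(\<lambda>y. indicator {0..} y * p y) \<in> borel_measurable borel"
  using borel_measurable_continuous_on_indicator[of "{0..}" p] cp
  by (simp add: censored_predictive_def)

lemma emeasure_cp:
  assumes "A \<in> sets borel"
  shows "emeasure M A = emeasure M {0} * indicator A 0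
    + (\<integral>\<^sup>+ y. ennreal (indicator {0..} y * p y) * indicator A y \<partial>lborel)"
proof -
  have "emeasure M A = emeasure M {0} * indicator A 0
      + (\<integral>\<^sup>+ y. ennreal (p y) * indicator (A \<inter> {0..}) y \<partial>lborel)"
    using cp assms unfolding censored_predictive_def by blast
  also have "(\<integral>\<^sup>+ y. ennreal (p y) * indicator (A \<inter> {0..}) y \<partial>lborel)
      = (\<integral>\<^sup>+ y. ennreal (indicator {0..} y * p y) * indicator A y \<partial>lborel)"
    by (intro nn_integral_cong) (simp split: split_indicator)
  finally show ?thesis .
qed

lemma borel_hpd_set: "hpd_set p \<kappa> \<in> sets borel"
proof -
  note [measurable] = measurable_density_cp
  have "hpd_set p \<kappa> = {0} \<union> ({0..} \<inter> {y \<in> space borel. \<kappa> \<le> indicator {0..} y * p y})"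
    by (auto simp: hpd_set_def)
  also have "\<dots> \<in> sets borel"
    by measurable
  finally show ?thesis .
qed

lemma hpd_set_nonpos:
  assumes "\<kappa> \<le> 0"
  shows "hpd_set p \<kappa> = {0..}"
  using assms density_nonneg_cp by (fastforce simp: hpd_set_def)

lemma AE_cp_nonneg: "AE y in M. 0 \<le> y"
proof (rule AE_I')
  have "(\<lambda>y. ennreal (indicator {0..} y * p y) * indicator {..<0} y) = (\<lambda>_. 0)"
    by (auto split: split_indicator)
  then have "emeasure M {..<0} = 0"
    by (subst emeasure_cp) simp_all
  then show "{..<0} \<in> null_sets M"
    by (auto simp: sets_cp)
qed auto

lemma measure_half_line_cp: "measure M {0..} = 1"
  using AE_cp_nonneg prob_Collect_eq_1[of "\<lambda>y. 0 \<le> y"]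
  by (simp add: sets_cp space_cp atLeast_def)

text \<open>Level \<open>0\<close> needs no null-set hypothesis, because \<open>M\<close> does not charge \<open>{p = 0} - {0}\<close>;
  this makes coverage continuous up to the threshold \<open>0\<close>, where it equals \<open>1\<close>.\<close>

lemma AE_cp_off_level:
  assumes "0 < t \<Longrightarrow> {y. 0 \<le> y \<and> p y = t} \<in> null_sets lborel" and "0 \<le> t"
  shows "AE y in M. 0 \<le> y \<and> (y = 0 \<or> p y \<noteq> t)"
proof -
  note [measurable] = measurable_density_cp
  define A where "A = {0<..} \<inter> {y \<in> space borel. indicator {0..} y * p y = t}"
  have A: "A \<in> sets borel"
    unfolding A_def by measurable
  have "AE y in lborel. ennreal (indicator {0..} y * p y) * indicator A y = 0"
  proof (cases "t = 0")
    case True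
    then show ?thesis
      by (auto simp: A_def split: split_indicator)
  next
    case False
    then have "{y. 0 \<le> y \<and> p y = t} \<in> null_sets lborel"
      using assms by simp
    then have "AE y in lborel. y \<notin> {y. 0 \<le> y \<and> p y = t}"
      by (rule AE_not_in)
    then show ?thesis
      by eventually_elim (auto simp: A_def split: split_indicator)
  qed
  then have "emeasure M A = 0"
    using A by (subst emeasure_cp) (simp_all add: nn_integral_0_iff_AE A_def)
  then have "A \<in> null_sets M"
    using A by (auto simp: sets_cp)
  then have "AE y in M. y \<notin> A"
    by (rule AE_not_in)
  with AE_cp_nonneg show ?thesis
    by eventually_elim (auto simp: A_def)
qed

section \<open>Coverage as a function of the threshold\<close>

lemma tendsto_measure_cp:
  assumes "\<And>n. A n \<in> sets borel" and "B \<in> sets borel"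
    and "AE y in M. (\<lambda>n. indicator (A n) y :: real) \<longlonglongrightarrow> indicator B y"
  shows "(\<lambda>n. measure M (A n)) \<longlonglongrightarrow> measure M B"
proof -
  have "(\<lambda>n. (\<integral>y. (indicator (A n) y :: real) \<partial>M)) \<longlonglongrightarrow> (\<integral>y. (indicator B y :: real) \<partial>M)"
    by (rule integral_dominated_convergence[where w = "\<lambda>_. 1"])
       (use assms in \<open>auto simp: measurable_cong_sets[OF sets_cp refl]\<close>)
  then show ?thesis
    by (simp add: space_cp)
qed

text \<open>For fixed y \<noteq> 0 in the half line, membership in the HPD set changes only as the
  threshold passes \<open>p y\<close>, and 0 is always a member. Indicators thus converge off the
  level set of the limit threshold, which \<open>M\<close> does not charge away from 0, and
  dominated convergence applies.\<close>

lemma continuous_on_measure_hpd_set: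
  assumes "\<forall>t>0. {y. 0 \<le> y \<and> p y = t} \<in> null_sets lborel"
  shows "continuous_on {0..} (\<lambda>\<kappa>. measure M (hpd_set p \<kappa>))"
  unfolding continuous_on_sequentially comp_def
proof (intro ballI allI impI, elim conjE)
  fix \<kappa> :: real and k :: "nat \<Rightarrow> real"
  assume "\<kappa> \<in> {0..}" and k: "k \<longlonglongrightarrow> \<kappa>"
  then have "AE y in M. 0 \<le> y \<and> (y = 0 \<or> p y \<noteq> \<kappa>)"
    using assms by (intro AE_cp_off_level) auto
  then have "AE y in M. (\<lambda>n. indicator (hpd_set p (k n)) y :: real) \<longlonglongrightarrow> indicator (hpd_set p \<kappa>) y"
  proof eventually_elim
    case (elim y)
    then consider "y = 0" | "y \<noteq> 0" "0 \<le> y" "p y < \<kappa>" | "y \<noteq> 0" "0 \<le> y" "\<kappa> < p y"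
      by linarith
    then have "\<forall>\<^sub>F n in sequentially. indicator (hpd_set p (k n)) y = (indicator (hpd_set p \<kappa>) y :: real)"
    proof cases
      case 1
      then show ?thesis by (simp add: hpd_set_def)
    next
      case 2
      from order_tendstoD(1)[OF k \<open>p y < \<kappa>\<close>] show ?thesis
        by eventually_elim (use 2 in \<open>simp add: hpd_set_def indicator_def\<close>)
    next
      case 3
      from order_tendstoD(2)[OF k \<open>\<kappa> < p y\<close>] show ?thesis
        by eventually_elim (use 3 in \<open>simp add: hpd_set_def indicator_def\<close>)
    qed
    then show ?case
      by (rule tendsto_eventually)
  qed
  then show "(\<lambda>n. measure M (hpd_set p (k n))) \<longlonglongrightarrow> measure M (hpd_set p \<kappa>)"
    by (intro tendsto_measure_cp borel_hpd_set)
qed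

text \<open>Each density value is eventually below n, so pointwise only 0 survives. Since
  \<open>p\<close> may be unbounded, the bare atom may be reached only in the limit.\<close>

lemma tendsto_measure_hpd_set_at_top:
  "(\<lambda>n. measure M (hpd_set p (real n))) \<longlonglongrightarrow> measure M {0}"
proof (intro tendsto_measure_cp borel_hpd_set AE_I2)
  fix y
  obtain m where m: "p y < real m"
    using reals_Archimedean2 by blast
  have "indicator (hpd_set p (real n)) y = (indicator {0} y :: real)" if "m \<le> n" for n
  proof -
    from that have "real m \<le> real n"
      by simp
    with m have "p y < real n"
      by linarith
    then show ?thesis
      by (simp add: hpd_set_def indicator_def)
  qed
  then show "(\<lambda>n. indicator (hpd_set p (real n)) y :: real) \<longlonglongrightarrow> indicator {0} y"
    by (intro tendsto_eventually eventually_sequentiallyI)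
qed simp

section \<open>The exchange inequality for one unit\<close>

lemma exchange_inequality_integral:
  assumes "A \<in> sets borel" and "B \<in> sets borel"
  shows "ennreal \<kappa> * emeasure lborel A + emeasure M B = emeasure M {0} * indicator B 0
    + (\<integral>\<^sup>+ y. ennreal \<kappa> * indicator A y
        + ennreal (indicator {0..} y * p y) * indicator B y \<partial>lborel)"
proof -
  note [measurable] = measurable_density_cp
  show ?thesis
    using assms
    by (subst nn_integral_add) (simp_all add: emeasure_cp[of B] nn_integral_cmult_indicator add.left_commute)
qed

text \<open>The sides differ only where exactly one of the two sets contains y: in the HPD set
  alone, \<kappa> \<le> \<open>p y\<close>; in \<open>D\<close> alone, \<open>p y\<close> <
  \<kappa>. The point 0 is excluded because it belongs to the HPD set even if its density is below
  \<kappa>.\<close>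

lemma exchange_integrand_le:
  assumes "0 < \<kappa>" and "D \<subseteq> {0..}" and "y \<noteq> 0"
  shows "ennreal \<kappa> * indicator (hpd_set p \<kappa>) y + ennreal (indicator {0..} y * p y) * indicator D y
    \<le> ennreal \<kappa> * indicator D y + ennreal (indicator {0..} y * p y) * indicator (hpd_set p \<kappa>) y"
  using assms density_nonneg_cp[of y]
  by (auto simp: hpd_set_def indicator_def add.commute intro: ennreal_leI)

text \<open>In Lagrangian terms, the HPD set minimizes \<kappa> times length minus coverage. Sums
  replace differences because \<open>D\<close> may have infinite length.\<close>

lemma exchange_inequality:
  assumes "0 < \<kappa>" and "D \<in> sets borel" and "D \<subseteq> {0..}"
  shows "ennreal \<kappa> * emeasure lborel (hpd_set p \<kappa>) + emeasure M D
    \<le> ennreal \<kappa> * emeasure lborel D + emeasure M (hpd_set p \<kappa>)"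
proof -
  have "AE y in lborel. y \<noteq> (0::real)"
    by (rule AE_lborel_singleton)
  then have "AE y in lborel.
      ennreal \<kappa> * indicator (hpd_set p \<kappa>) y + ennreal (indicator {0..} y * p y) * indicator D y
      \<le> ennreal \<kappa> * indicator D y + ennreal (indicator {0..} y * p y) * indicator (hpd_set p \<kappa>) y"
    by eventually_elim (use assms in \<open>auto intro: exchange_integrand_le\<close>)
  \<comment> \<open>The atom is compared separately: the HPD set always contains 0, while
    \<open>D\<close> may omit it.\<close>
  moreover have "emeasure M {0} * indicator D 0 \<le> emeasure M {0} * indicator (hpd_set p \<kappa>) 0"
    by (intro mult_left_mono) (auto simp: hpd_set_def indicator_def)
  ultimately show ?thesis
    using assms
    by (simp only: exchange_inequality_integral borel_hpd_set) (intro add_mono nn_integral_mono_AE)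
qed

text \<open>A Markov-type bound: with the empty set as competitor, the exchange inequality says that
  \<kappa> times the length is at most the coverage, hence finite.\<close>

lemma emeasure_hpd_set_less_top:
  assumes "0 < \<kappa>"
  shows "emeasure lborel (hpd_set p \<kappa>) < \<infinity>"
proof -
  have "ennreal \<kappa> * emeasure lborel (hpd_set p \<kappa>) \<le> emeasure M (hpd_set p \<kappa>)"
    using exchange_inequality[OF assms, of "{}"] by simp
  also have "\<dots> < \<infinity>"
    by (simp add: emeasure_eq_measure)
  finally show ?thesis
    using assms by (auto simp: ennreal_mult_less_top)
qed

text \<open>At points of the lower-threshold set outside the other one, the integrands are
  \<open>p y\<close> and \<kappa>, with \<open>p y\<close> < \<kappa>. If these points formed a null
  set, the lower-threshold set could not be longer.\<close>

lemma exchange_inequality_strict: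
  assumes "0 < \<kappa>" and "\<kappa>' < \<kappa>"
    and longer: "emeasure lborel (hpd_set p \<kappa>) < emeasure lborel (hpd_set p \<kappa>')"
  shows "ennreal \<kappa> * emeasure lborel (hpd_set p \<kappa>) + emeasure M (hpd_set p \<kappa>')
    < ennreal \<kappa> * emeasure lborel (hpd_set p \<kappa>') + emeasure M (hpd_set p \<kappa>)"
proof -
  note [measurable] = measurable_density_cp borel_hpd_set
  let ?C = "hpd_set p \<kappa>" and ?D = "hpd_set p \<kappa>'"
  let ?r = "\<lambda>y. ennreal (indicator {0..} y * p y)"
  let ?f = "\<lambda>y. ennreal \<kappa> * indicator ?C y + ?r y * indicator ?D y"
  let ?g = "\<lambda>y. ennreal \<kappa> * indicator ?D y + ?r y * indicator ?C y"
  \<comment> \<open>Strict comparison of the integrals requires the smaller one to be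
    finite.\<close>
  have "ennreal \<kappa> * emeasure lborel ?C + emeasure M ?D < \<infinity>"
    using emeasure_hpd_set_less_top[OF \<open>0 < \<kappa>\<close>]
    by (simp add: emeasure_eq_measure ennreal_mult_less_top)
  then have fin: "integral\<^sup>N lborel ?f \<noteq> \<infinity>"
    by (auto simp: exchange_inequality_integral borel_hpd_set)
  have "AE y in lborel. y \<noteq> (0::real)"
    by (rule AE_lborel_singleton)
  then have le: "AE y in lborel. ?f y \<le> ?g y"
    by eventually_elim (rule exchange_integrand_le[OF \<open>0 < \<kappa>\<close> hpd_set_subset])
  have "\<not> (AE y in lborel. ?g y \<le> ?f y)"
  proof
    assume "AE y in lborel. ?g y \<le> ?f y"
    then have "AE y in lborel. y \<in> ?D \<longrightarrow> y \<in> ?C"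
    proof eventually_elim
      case (elim y)
      show ?case
      proof (intro impI, rule ccontr)
        assume y: "y \<in> ?D" "y \<notin> ?C"
        then have "0 \<le> y" "p y < \<kappa>"
          by (auto simp: hpd_set_def)
        with elim y \<open>0 < \<kappa>\<close> show False
          using density_nonneg_cp[of y] by simp
      qed
    qed
    then have "emeasure lborel ?D \<le> emeasure lborel ?C"
      by (intro emeasure_mono_AE) simp_all
    with longer show False
      by simp
  qed
  with fin le have "integral\<^sup>N lborel ?f < integral\<^sup>N lborel ?g"
    by (intro nn_integral_less) simp_all
  \<comment> \<open>Both sets contain 0, so the same atom is added on both sides; being finite, it
    preserves strictness.\<close>
  moreover have "emeasure M {0} \<noteq> \<infinity>"
    by simp
  ultimately show ?thesis
    by (simp add: exchange_inequality_integral borel_hpd_set zero_in_hpd_set ennreal_add_left_cancel_less)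
qed

end

section \<open>Averages over the units\<close>

lemma avg_length_eq:
  "avg_length N C = enn2ereal (\<Sum>i=1..N. emeasure lborel (C i)) / ereal (real N)"
  by (simp add: avg_length_def forecast_length_def sum_enn2ereal)

lemma avg_length_mono:
  assumes "(\<Sum>i=1..N. emeasure lborel (C i)) \<le> (\<Sum>i=1..N. emeasure lborel (D i))"
  shows "avg_length N C \<le> avg_length N D"
  using assms unfolding avg_length_eq
  by (cases "N = 0") (auto intro!: ereal_divide_right_mono simp: less_eq_ennreal.rep_eq)

lemma avg_length_strict_mono:
  assumes "1 \<le> N"
    and "(\<Sum>i=1..N. emeasure lborel (C i)) < (\<Sum>i=1..N. emeasure lborel (D i))"
  shows "avg_length N C < avg_length N D"
  using assms unfolding avg_length_eq
  by (simp add: divide_ereal_def ereal_mult_strict_right_mono less_ennreal.rep_eq)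

lemma sum_emeasure_prob_space:
  assumes "\<And>i. i \<in> I \<Longrightarrow> prob_space (P i)"
  shows "(\<Sum>i\<in>I. emeasure (P i) (C i)) = ennreal (\<Sum>i\<in>I. measure (P i) (C i))"
proof -
  have "emeasure (P i) (C i) = ennreal (measure (P i) (C i))" if "i \<in> I" for i
  proof -
    interpret prob_space "P i" by (rule assms[OF that])
    show ?thesis by (rule emeasure_eq_measure)
  qed
  then show ?thesis
    by (simp add: sum_ennreal)
qed

text \<open>This serves twice: as the left end point for the intermediate value theorem, and to show
  that a threshold with coverage 1 - \<alpha> < 1 must be positive.\<close>

lemma avg_coverage_half_line:
  assumes "1 \<le> N" and "\<And>i. i \<in> {1..N} \<Longrightarrow> censored_predictive (P i) (p i)" and "\<kappa> \<le> 0"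
  shows "avg_coverage N P (\<lambda>i. hpd_set (p i) \<kappa>) = 1"
proof -
  have "measure (P i) (hpd_set (p i) \<kappa>) = 1" if "i \<in> {1..N}" for i
    using hpd_set_nonpos[OF assms(2)[OF that] assms(3)] measure_half_line_cp[OF assms(2)[OF that]] by simp
  then show ?thesis
    using \<open>1 \<le> N\<close> by (simp add: avg_coverage_def)
qed

section \<open>Existence and optimality of the common threshold\<close>

lemma exists_common_threshold:
  assumes "1 \<le> N" and "0 < \<alpha>"
    and cp: "\<And>i. i \<in> {1..N} \<Longrightarrow> censored_predictive (P i) (p i)"
    and low: "avg_coverage N P (\<lambda>i. {0}) < 1 - \<alpha>"
    and null: "\<forall>i\<in>{1..N}. \<forall>t>0. {y. 0 \<le> y \<and> p i y = t} \<in> null_sets lborel"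
  shows "\<exists>\<kappa>>0. avg_coverage N P (\<lambda>i. hpd_set (p i) \<kappa>) = 1 - \<alpha>"
proof -
  let ?G = "\<lambda>\<kappa>. avg_coverage N P (\<lambda>i. hpd_set (p i) \<kappa>)"
  have cont: "continuous_on {0..} ?G"
    unfolding avg_coverage_def
    by (intro continuous_intros continuous_on_measure_hpd_set cp) (use null \<open>1 \<le> N\<close> in auto)
  have "(\<lambda>n. ?G (real n)) \<longlonglongrightarrow> avg_coverage N P (\<lambda>i. {0})"
    unfolding avg_coverage_def
    by (intro tendsto_intros tendsto_measure_hpd_set_at_top cp) (use \<open>1 \<le> N\<close> in auto)
  \<comment> \<open>Strictness in \<open>low\<close> brings coverage below 1 - \<alpha> at a finite
    threshold, the right end point for the intermediate value theorem.\<close>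
  from order_tendstoD(2)[OF this low] obtain n where n: "?G (real n) < 1 - \<alpha>"
    by (auto simp: eventually_sequentially)
  have G0: "?G 0 = 1"
    using assms by (intro avg_coverage_half_line) auto
  have "\<exists>\<kappa>\<ge>0. \<kappa> \<le> real n \<and> ?G \<kappa> = 1 - \<alpha>"
  proof (rule IVT2')
    show "continuous_on {0..real n} ?G"
      by (rule continuous_on_subset[OF cont]) auto
  qed (use n G0 \<open>0 < \<alpha>\<close> in auto)
  then obtain \<kappa> where \<kappa>: "0 \<le> \<kappa>" "?G \<kappa> = 1 - \<alpha>"
    by blast
  with G0 \<open>0 < \<alpha>\<close> have "\<kappa> \<noteq> 0"
    by auto
  with \<kappa> show ?thesis
    by (intro exI[of _ \<kappa>]) auto
qed

text \<open>The common \<kappa> acts as a single multiplier, so the exchange inequalities can be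
  summed over units. A feasible competitor covers at least 1 - \<alpha>, exactly what the HPD sets
  cover, so the inequality between lengths remains.\<close>

lemma common_threshold_shortest:
  assumes "1 \<le> N" and "0 < \<alpha>"
    and cp: "\<And>i. i \<in> {1..N} \<Longrightarrow> censored_predictive (P i) (p i)"
    and cov: "avg_coverage N P (\<lambda>i. hpd_set (p i) \<kappa>) = 1 - \<alpha>"
  shows "shortest_forecast N P \<alpha> (\<lambda>i. hpd_set (p i) \<kappa>)"
  unfolding shortest_forecast_def
proof (intro conjI allI impI)
  let ?C = "\<lambda>i. hpd_set (p i) \<kappa>"
  show "feasible_forecast N P \<alpha> ?C"
    using cov borel_hpd_set[OF cp] by (auto simp: feasible_forecast_def hpd_set_def)
  fix D assume D: "feasible_forecast N P \<alpha> D"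
  have \<kappa>: "0 < \<kappa>"
    using avg_coverage_half_line[of N P p \<kappa>, OF \<open>1 \<le> N\<close> cp] cov \<open>0 < \<alpha>\<close> by force
  let ?lC = "\<Sum>i=1..N. emeasure lborel (?C i)" and ?lD = "\<Sum>i=1..N. emeasure lborel (D i)"
  let ?PC = "\<Sum>i=1..N. emeasure (P i) (?C i)" and ?PD = "\<Sum>i=1..N. emeasure (P i) (D i)"
  have PC: "?PC = ennreal (\<Sum>i=1..N. measure (P i) (?C i))"
    by (intro sum_emeasure_prob_space prob_space_cp[OF cp])
  have PD: "?PD = ennreal (\<Sum>i=1..N. measure (P i) (D i))"
    by (intro sum_emeasure_prob_space prob_space_cp[OF cp])
  have "avg_coverage N P ?C \<le> avg_coverage N P D"
    using D cov by (simp add: feasible_forecast_def)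
  then have "?PC \<le> ?PD"
    unfolding PC PD using \<open>1 \<le> N\<close> by (intro ennreal_leI) (simp add: avg_coverage_def divide_le_cancel)
  then have "ennreal \<kappa> * ?lC + ?PC \<le> ennreal \<kappa> * ?lC + ?PD"
    by (rule add_left_mono)
  also have "\<dots> = (\<Sum>i=1..N. ennreal \<kappa> * emeasure lborel (?C i) + emeasure (P i) (D i))"
    by (simp add: sum.distrib sum_distrib_left)
  also have "\<dots> \<le> (\<Sum>i=1..N. ennreal \<kappa> * emeasure lborel (D i) + emeasure (P i) (?C i))"
    using D \<kappa> by (intro sum_mono exchange_inequality cp) (auto simp: feasible_forecast_def)
  also have "\<dots> = ennreal \<kappa> * ?lD + ?PC"
    by (simp add: sum.distrib sum_distrib_left)
  \<comment> \<open>The total coverage \<open>?PC\<close> is finite and cancels, even if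
    \<open>?lD\<close> is infinite.\<close>
  finally have "ennreal \<kappa> * ?lC \<le> ennreal \<kappa> * ?lD"
    unfolding PC by (simp add: add.commute[of _ "ennreal (sum _ _)"] ennreal_add_left_cancel_le)
  then have "?lC \<le> ?lD"
    using \<kappa> by (simp add: ennreal_mult_le_mult_iff)
  then show "avg_length N ?C \<le> avg_length N D"
    by (rule avg_length_mono)
qed

section \<open>Lowering one threshold and raising another\<close>

lemma perturbed_thresholds_longer:
  assumes cp_q: "censored_predictive M q" and cp_r: "censored_predictive K r"
    and "0 < \<kappa>" and "\<kappa>\<^sub>q < \<kappa>"
    and longer: "emeasure lborel (hpd_set q \<kappa>) < emeasure lborel (hpd_set q \<kappa>\<^sub>q)"
    and coverage: "measure M (hpd_set q \<kappa>\<^sub>q) + measure K (hpd_set r \<kappa>\<^sub>r)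
      = measure M (hpd_set q \<kappa>) + measure K (hpd_set r \<kappa>)"
  shows "emeasure lborel (hpd_set q \<kappa>) + emeasure lborel (hpd_set r \<kappa>)
    < emeasure lborel (hpd_set q \<kappa>\<^sub>q) + emeasure lborel (hpd_set r \<kappa>\<^sub>r)"
    (is "?a + ?b < ?c + ?d")
proof -
  interpret M: prob_space M by (rule prob_space_cp[OF cp_q])
  interpret K: prob_space K by (rule prob_space_cp[OF cp_r])
  let ?PC = "emeasure M (hpd_set q \<kappa>) + emeasure K (hpd_set r \<kappa>)"
  have PD: "emeasure M (hpd_set q \<kappa>\<^sub>q) + emeasure K (hpd_set r \<kappa>\<^sub>r) = ?PC"
    using coverage by (simp add: M.emeasure_eq_measure K.emeasure_eq_measure flip: ennreal_plus)
  have j: "ennreal \<kappa> * ?b + emeasure K (hpd_set r \<kappa>\<^sub>r)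
      \<le> ennreal \<kappa> * ?d + emeasure K (hpd_set r \<kappa>)"
    by (intro exchange_inequality cp_r borel_hpd_set[OF cp_r] hpd_set_subset \<open>0 < \<kappa>\<close>)
  \<comment> \<open>This term is added to a strict inequality below, which stays strict only for a
    finite summand.\<close>
  have finj: "ennreal \<kappa> * ?b + emeasure K (hpd_set r \<kappa>\<^sub>r) < \<infinity>"
    using emeasure_hpd_set_less_top[OF cp_r \<open>0 < \<kappa>\<close>]
    by (simp add: ennreal_mult_less_top K.emeasure_eq_measure)
  \<comment> \<open>Replacing \<open>?PC\<close> by the equal perturbed coverage produces the
    left-hand sides of two exchange inequalities: a strict one for the lengthened set and a weak one
    for the other unit.\<close>
  have "ennreal \<kappa> * (?a + ?b) + ?PC
      = (ennreal \<kappa> * ?a + emeasure M (hpd_set q \<kappa>\<^sub>q))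
        + (ennreal \<kappa> * ?b + emeasure K (hpd_set r \<kappa>\<^sub>r))"
    unfolding PD[symmetric] distrib_left by (simp only: ac_simps)
  also have "\<dots> < (ennreal \<kappa> * ?c + emeasure M (hpd_set q \<kappa>))
        + (ennreal \<kappa> * ?b + emeasure K (hpd_set r \<kappa>\<^sub>r))"
    using exchange_inequality_strict[OF cp_q \<open>0 < \<kappa>\<close> \<open>\<kappa>\<^sub>q < \<kappa>\<close> longer] finj
    by (subst (1 2) add.commute) (auto simp: ennreal_add_left_cancel_less)
  also have "\<dots> \<le> (ennreal \<kappa> * ?c + emeasure M (hpd_set q \<kappa>))
        + (ennreal \<kappa> * ?d + emeasure K (hpd_set r \<kappa>))"
    using j by (rule add_left_mono)
  also have "\<dots> = ennreal \<kappa> * (?c + ?d) + ?PC"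
    by (simp add: distrib_left ac_simps)
  \<comment> \<open>By contraposition: adding \<open>?PC\<close> would preserve the reverse
    inequality. Multiplication by \<kappa> is removed in the same way.\<close>
  finally have "ennreal \<kappa> * (?a + ?b) < ennreal \<kappa> * (?c + ?d)"
    using add_right_mono leD leI by metis
  then show ?thesis
    using mult_left_mono leD leI zero_le by metis
qed

text \<open>\<open>C\<close> plays the lengthened set, which is the whole half line for a
  nonpositive threshold and so may be infinitely long. The other lengths are finite, so the extended
  real differences behave as expected.\<close>

lemma length_changes_less:
  assumes "emeasure lborel A < \<infinity>" and "emeasure lborel B < \<infinity>" and "emeasure lborel D < \<infinity>"
    and "emeasure lborel A + emeasure lborel B < emeasure lborel C + emeasure lborel D"
  shows "- (forecast_length D - forecast_length B) < forecast_length C - forecast_length A"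
  using assms unfolding forecast_length_def
  by (cases "emeasure lborel A"; cases "emeasure lborel B";
      cases "emeasure lborel C"; cases "emeasure lborel D")
     (auto simp: ennreal_less_iff enn2ereal_ennreal simp flip: ennreal_plus)

lemma sum_remove_two:
  fixes f :: "'a \<Rightarrow> 'b::comm_monoid_add"
  assumes "finite A" and "i \<in> A" and "j \<in> A" and "i \<noteq> j"
  shows "sum f A = f i + f j + sum f (A - {i, j})"
proof -
  have "sum f A = f i + sum f (A - {i})"
    using assms by (simp add: sum.remove)
  also have "sum f (A - {i}) = f j + sum f (A - {i} - {j})"
    using assms by (intro sum.remove) auto
  also have "A - {i} - {j} = A - {i, j}"
    by auto
  finally show ?thesis
    by (simp add: add.assoc)
qed

text \<open>Existence is conditional: atoms alone may already exceed 1 - \<alpha> on average, and a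
  density level set of positive length can make coverage jump past 1 - \<alpha>.\<close>

theorem mainTheorem2:
  fixes N :: nat and \<alpha> :: real
    and P :: "nat \<Rightarrow> real measure" and p :: "nat \<Rightarrow> real \<Rightarrow> real"
  assumes "1 \<le> N" and "0 < \<alpha>" and "\<alpha> < 1"
    and "\<And>i. i \<in> {1..N} \<Longrightarrow> censored_predictive (P i) (p i)"
  shows
    "(avg_coverage N P (\<lambda>i. {0}) < 1 - \<alpha> \<and>
      (\<forall>i\<in>{1..N}. \<forall>t>0. {y. 0 \<le> y \<and> p i y = t} \<in> null_sets lborel)
        \<longrightarrow> (\<exists>\<kappa>>0. avg_coverage N P (\<lambda>i. hpd_set (p i) \<kappa>) = 1 - \<alpha>))
    \<and> (\<forall>\<kappa>. avg_coverage N P (\<lambda>i. hpd_set (p i) \<kappa>) = 1 - \<alpha>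
        \<longrightarrow> shortest_forecast N P \<alpha> (\<lambda>i. hpd_set (p i) \<kappa>))
    \<and> (\<forall>\<kappa> \<kappa>\<^sub>i \<kappa>\<^sub>j \<delta>\<^sub>i \<delta>\<^sub>j C'. \<forall>i\<in>{1..N}. \<forall>j\<in>{1..N}.
          0 < \<kappa> \<and> i \<noteq> j \<and> \<kappa>\<^sub>i < \<kappa> \<and> \<kappa> < \<kappa>\<^sub>j
        \<and> C' = (\<lambda>k. hpd_set (p k) (((\<lambda>_. \<kappa>)(i := \<kappa>\<^sub>i, j := \<kappa>\<^sub>j)) k))
        \<and> \<delta>\<^sub>i = forecast_length (C' i) - forecast_length (hpd_set (p i) \<kappa>) \<and> 0 < \<delta>\<^sub>i
        \<and> \<delta>\<^sub>j = forecast_length (C' j) - forecast_length (hpd_set (p j) \<kappa>) \<and> \<delta>\<^sub>j < 0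
        \<and> avg_coverage N P C' = avg_coverage N P (\<lambda>k. hpd_set (p k) \<kappa>)
        \<longrightarrow> - \<delta>\<^sub>j < \<delta>\<^sub>i \<and> avg_length N (\<lambda>k. hpd_set (p k) \<kappa>) < avg_length N C')"
proof (intro conjI)
  show "avg_coverage N P (\<lambda>i. {0}) < 1 - \<alpha> \<and>
      (\<forall>i\<in>{1..N}. \<forall>t>0. {y. 0 \<le> y \<and> p i y = t} \<in> null_sets lborel)
        \<longrightarrow> (\<exists>\<kappa>>0. avg_coverage N P (\<lambda>i. hpd_set (p i) \<kappa>) = 1 - \<alpha>)"
    using exists_common_threshold[of N \<alpha> P p] assms by blast
  show "\<forall>\<kappa>. avg_coverage N P (\<lambda>i. hpd_set (p i) \<kappa>) = 1 - \<alpha>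
      \<longrightarrow> shortest_forecast N P \<alpha> (\<lambda>i. hpd_set (p i) \<kappa>)"
    using common_threshold_shortest[of N \<alpha> P p] assms by blast
next
  show "\<forall>\<kappa> \<kappa>\<^sub>i \<kappa>\<^sub>j \<delta>\<^sub>i \<delta>\<^sub>j C'. \<forall>i\<in>{1..N}. \<forall>j\<in>{1..N}.
          0 < \<kappa> \<and> i \<noteq> j \<and> \<kappa>\<^sub>i < \<kappa> \<and> \<kappa> < \<kappa>\<^sub>j
        \<and> C' = (\<lambda>k. hpd_set (p k) (((\<lambda>_. \<kappa>)(i := \<kappa>\<^sub>i, j := \<kappa>\<^sub>j)) k))
        \<and> \<delta>\<^sub>i = forecast_length (C' i) - forecast_length (hpd_set (p i) \<kappa>) \<and> 0 < \<delta>\<^sub>i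
        \<and> \<delta>\<^sub>j = forecast_length (C' j) - forecast_length (hpd_set (p j) \<kappa>) \<and> \<delta>\<^sub>j < 0
        \<and> avg_coverage N P C' = avg_coverage N P (\<lambda>k. hpd_set (p k) \<kappa>)
        \<longrightarrow> - \<delta>\<^sub>j < \<delta>\<^sub>i \<and> avg_length N (\<lambda>k. hpd_set (p k) \<kappa>) < avg_length N C'"
  proof (intro allI ballI impI, elim conjE)
    fix \<kappa> \<kappa>\<^sub>i \<kappa>\<^sub>j \<delta>\<^sub>i \<delta>\<^sub>j C' i j
    assume ij: "i \<in> {1..N}" "j \<in> {1..N}" "i \<noteq> j" and \<kappa>: "0 < \<kappa>" "\<kappa>\<^sub>i < \<kappa>" "\<kappa> < \<kappa>\<^sub>j"
      and C': "C' = (\<lambda>k. hpd_set (p k) (((\<lambda>_. \<kappa>)(i := \<kappa>\<^sub>i, j := \<kappa>\<^sub>j)) k))"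
      and \<delta>: "\<delta>\<^sub>i = forecast_length (C' i) - forecast_length (hpd_set (p i) \<kappa>)" "0 < \<delta>\<^sub>i"
        "\<delta>\<^sub>j = forecast_length (C' j) - forecast_length (hpd_set (p j) \<kappa>)"
      and cov: "avg_coverage N P C' = avg_coverage N P (\<lambda>k. hpd_set (p k) \<kappa>)"
    let ?C = "\<lambda>k. hpd_set (p k) \<kappa>" and ?R = "{1..N} - {i, j}"
    note cp = assms(4)
    have C'_simps: "C' i = hpd_set (p i) \<kappa>\<^sub>i" "C' j = hpd_set (p j) \<kappa>\<^sub>j"
      and C'_rest: "\<And>k. k \<in> ?R \<Longrightarrow> C' k = ?C k"
      using ij by (auto simp: C')
    note split = sum_remove_two[OF finite_atLeastAtMost ij]
    have finC: "emeasure lborel (?C k) < \<infinity>" if "k \<in> {1..N}" for k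
      using emeasure_hpd_set_less_top[OF cp[OF that] \<kappa>(1)] .
    have finj: "emeasure lborel (C' j) < \<infinity>"
      using emeasure_hpd_set_less_top[OF cp[OF ij(2)]] \<kappa> by (simp add: C'_simps)
    \<comment> \<open>Finiteness of the original length lets the sign of
      \<open>\<delta>\<^sub>i\<close> decide which set is longer.\<close>
    have longer: "emeasure lborel (?C i) < emeasure lborel (C' i)"
      using \<delta>(1,2) finC[OF ij(1)]
      by (cases "emeasure lborel (?C i)"; cases "emeasure lborel (C' i)")
         (auto simp: forecast_length_def enn2ereal_ennreal ennreal_less_iff)
    have "(\<Sum>k=1..N. measure (P k) (C' k)) = (\<Sum>k=1..N. measure (P k) (?C k))"
      using cov \<open>1 \<le> N\<close> by (simp add: avg_coverage_def)
    moreover have "(\<Sum>k\<in>?R. measure (P k) (C' k)) = (\<Sum>k\<in>?R. measure (P k) (?C k))"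
      by (intro sum.cong refl) (simp add: C'_rest)
    ultimately have coverage: "measure (P i) (C' i) + measure (P j) (C' j)
        = measure (P i) (?C i) + measure (P j) (?C j)"
      unfolding split by simp
    have less: "emeasure lborel (?C i) + emeasure lborel (?C j)
        < emeasure lborel (C' i) + emeasure lborel (C' j)"
      using perturbed_thresholds_longer[OF cp[OF ij(1)] cp[OF ij(2)] \<kappa>(1,2)] longer coverage
      by (simp add: C'_simps)
    have "- \<delta>\<^sub>j < \<delta>\<^sub>i"
      unfolding \<delta>(1,3) using less finC ij finj by (intro length_changes_less) auto
    have "(\<Sum>k\<in>?R. emeasure lborel (C' k)) = (\<Sum>k\<in>?R. emeasure lborel (?C k))"
      by (intro sum.cong refl) (simp add: C'_rest)
    \<comment> \<open>The unperturbed units contribute a common finite length, so strictness for the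
      two perturbed units carries over to the total.\<close>
    moreover have "(\<Sum>k\<in>?R. emeasure lborel (?C k)) \<noteq> \<infinity>"
      using finC by (force simp: less_top)
    ultimately have "(\<Sum>k=1..N. emeasure lborel (?C k)) < (\<Sum>k=1..N. emeasure lborel (C' k))"
      unfolding split using less
      by (simp only: add.commute[of _ "sum _ _"] ennreal_add_left_cancel_less) simp
    then have "avg_length N ?C < avg_length N C'"
      by (rule avg_length_strict_mono[OF \<open>1 \<le> N\<close>])
    with \<open>- \<delta>\<^sub>j < \<delta>\<^sub>i\<close> show "- \<delta>\<^sub>j < \<delta>\<^sub>i \<and> avg_length N ?C < avg_length N C'" ..
  qed
qed

end
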